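(* Let $\mathbb{Z}$ be a finite dimensional real inner product space with induced norm $\|\cdot\|$, let $\mathcal{A}:\mathbb{Z}\rightrightarrows\mathbb{Z}$ be maximal monotone, let $\mathcal{C}:\mathbb{Z}\to\mathbb{Z}$ be $\beta$-cocoercive with $\beta>0$, put $\mathcal{F}:=\mathcal{A}+\mathcal{C}$, and assume $\mathcal{F}^{-1}(0)\ne\emptyset$. Let $\gamma\in(0,2\beta)$, $\delta=\min\big(1,\frac{\beta}{\gamma}\big)+\frac12$, and let $\{\lambda_k\}_{k\ge 0}\subseteq[0,\delta]$ satisfy $\sum_{k=0}^\infty\lambda_k(\delta-\lambda_k)=+\infty$. Let $\mathcal{T}:=\mathcal{J}_{\gamma\mathcal{A}}(\mathcal{I}-\gamma\mathcal{C})$ and let $\{z^k\}$ be generated from an arbitrary $z^0\in\mathbb{Z}$ by the over-relaxed forward-backward splitting algorithm $$z^{k+1}=z^k+\lambda_k\big(\mathcal{J}_{\gamma\mathcal{A}}(\mathcal{I}-\gamma\mathcal{C})z^k-z^k\big),\qquad k\in\mathbb{N}.$$ Then the following hold. (a) The sequences $\{z^k\}$ and $\{\mathcal{T}z^k\}$ converge to a point $z^*\in{\rm Fix}\,\mathcal{T}=\mathcal{F}^{-1}(0)$, and $$\|z^{k+1}-z\|^2\le\|z^k-z\|^2-\lambda_k(\delta-\lambda_k)\|\mathcal{T}z^k-z^k\|^2\qquad\forall z\in\mathcal{F}^{-1}(0),\ \forall k\in\mathbb{N}.$$ (b) If in addition $\mathcal{F}$ is metrically subregular at $(z^*,0)\in{\rm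 gph}\,\mathcal{F}$ with constant $\kappa>0$, then there exists $\overline{k}\in\mathbb{N}$ such that for all $k\ge\overline{k}$, $${\rm dist}\big(z^{k+1},\mathcal{F}^{-1}(0)\big)\le\sqrt{1-\frac{\gamma^2\lambda_k(\delta-\lambda_k)}{(\gamma+\kappa)^2}}\;{\rm dist}\big(z^k,\mathcal{F}^{-1}(0)\big).$$
   Context: For an operator $\mathcal{T}:\mathbb{Z}\rightrightarrows\mathbb{Z}$ (set-valued map) and $\gamma>0$, $\mathcal{J}_{\gamma\mathcal{T}}=(\mathcal{I}+\gamma\mathcal{T})^{-1}$ denotes its resolvent, where $\mathcal{I}$ is the identity. ${\rm gph}\,\mathcal{T}=\{(x,y): y\in\mathcal{T}(x)\}$, $\mathcal{T}^{-1}(y)=\{x: y\in\mathcal{T}(x)\}$, ${\rm Fix}\,\mathcal{T}$ is the set of fixed points of a single-valued map $\mathcal{T}$, and ${\rm dist}(x,S)=\inf_{s\in S}\|x-s\|$ (equal to $+\infty$ if $S=\emptyset$). $\mathcal{C}$ is $\beta$-cocoercive if $\langle x-y,\mathcal{C}x-\mathcal{C}y\rangle\ge\beta\|\mathcal{C}x-\mathcal{C}y\|^2$ for all $x,y\in\mathbb{Z}$. An operator $\mathcal{T}$ is metrically subregular at $(\overline{x},\overline{y})\in{\rm gph}\,\mathcal{T}$ with constant $\kappa>0$ if there is a neighborhood $U$ of $\overline{x}$ such that ${\rm dist}(x,\mathcal{T}^{-1}(\overline{y}))\le\kappa\,{\rm dist}(\overline{y},\mathcal{T}x)$ for all $x\in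 U$. *)

theory Defs
  imports "HOL-Analysis.Analysis"
begin

text \<open>A set-valued operator on \<^typ>\<open>'a\<close> is a function of type \<^typ>\<open>'a \<Rightarrow> 'a set\<close>.\<close>

definition gph :: "('a \<Rightarrow> 'a set) \<Rightarrow> ('a \<times> 'a) set" where
  "gph T = {(x, y). y \<in> T x}"

definition op_inverse :: "('a \<Rightarrow> 'a set) \<Rightarrow> 'a \<Rightarrow> 'a set" where
  "op_inverse T y = {x. y \<in> T x}"

definition op_single :: "('a \<Rightarrow> 'a) \<Rightarrow> 'a \<Rightarrow> 'a set" where
  "op_single f x = {f x}"

definition op_plus :: "('a \<Rightarrow> 'a set) \<Rightarrow> ('a \<Rightarrow> 'a set) \<Rightarrow> 'a \<Rightarrow> 'a::real_vector set" where
  "op_plus S T x = {u + v | u v. u \<in> S x \<and> v \<in> T x}"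

definition op_scale :: "real \<Rightarrow> ('a \<Rightarrow> 'a set) \<Rightarrow> 'a \<Rightarrow> 'a::real_vector set" where
  "op_scale c T x = (\<lambda>u. c *\<^sub>R u) ` T x"

definition monotone_operator :: "('a::real_inner \<Rightarrow> 'a set) \<Rightarrow> bool" where
  "monotone_operator T \<longleftrightarrow>
     (\<forall>x y. \<forall>u\<in>T x. \<forall>v\<in>T y. inner (x - y) (u - v) \<ge> 0)"

definition maximal_monotone :: "('a::real_inner \<Rightarrow> 'a set) \<Rightarrow> bool" where
  "maximal_monotone T \<longleftrightarrow> monotone_operator T \<and>
     (\<forall>S. monotone_operator S \<and> gph T \<subseteq> gph S \<longrightarrow> gph S = gph T)"

definition cocoercive :: "real \<Rightarrow> ('a::real_inner \<Rightarrow> 'a) \<Rightarrow> bool" where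
  "cocoercive \<beta> C \<longleftrightarrow>
     (\<forall>x y. inner (x - y) (C x - C y) \<ge> \<beta> * (norm (C x - C y))\<^sup>2)"

definition resolvent :: "real \<Rightarrow> ('a \<Rightarrow> 'a set) \<Rightarrow> 'a \<Rightarrow> 'a::real_vector set" where
  "resolvent \<gamma> T = op_inverse (op_plus (op_single id) (op_scale \<gamma> T))"

text \<open>The resolvent of a maximal monotone operator is single-valued with full domain
  (Minty's theorem), so \<^const>\<open>the_elem\<close> below selects its unique value.\<close>

definition resolvent_map :: "real \<Rightarrow> ('a \<Rightarrow> 'a set) \<Rightarrow> 'a \<Rightarrow> 'a::real_vector" where
  "resolvent_map \<gamma> T x = the_elem (resolvent \<gamma> T x)"

definition Fix :: "('a \<Rightarrow> 'a) \<Rightarrow> 'a set" where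
  "Fix f = {x. f x = x}"

text \<open>Extended-real valued so that the distance to the empty set is \<^term>\<open>\<infinity>::ereal\<close>;
  the library's \<^const>\<open>infdist\<close> would return \<^term>\<open>0::real\<close> there.\<close>

definition set_edist :: "'a::real_normed_vector \<Rightarrow> 'a set \<Rightarrow> ereal" where
  "set_edist x S = (INF s\<in>S. ereal (norm (x - s)))"

definition metrically_subregular ::
    "('a::real_normed_vector \<Rightarrow> 'a set) \<Rightarrow> 'a \<Rightarrow> 'a \<Rightarrow> real \<Rightarrow> bool" where
  "metrically_subregular T xbar ybar \<kappa> \<longleftrightarrow>
     (xbar, ybar) \<in> gph T \<and> \<kappa> > 0 \<and>
     (\<exists>U. open U \<and> xbar \<in> U \<and>
        (\<forall>x\<in>U. set_edist x (op_inverse T ybar) \<le> ereal \<kappa> * set_edist ybar (T x)))"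

end

theory Submission
  imports Defs
begin

text \<open>
  Write \<open>J\<close> for the resolvent of \<open>\<gamma>A\<close> and \<open>T x = J (x - \<gamma> C x)\<close>. Everything rests on Minty's
  theorem, which makes \<open>J\<close> single-valued with full domain: \<open>p = J y\<close> holds exactly if
  \<open>(y - p) / \<gamma> \<in> A p\<close> (\<open>resolvent_map_eq_iff\<close>). In finite dimension it is a statement about
  intersections of closed balls. The pair \<open>(x, -x)\<close> is monotonically related to a point \<open>(a, u)\<close> of the
  graph exactly if \<open>x\<close> lies in the ball with diameter \<open>[a, -u]\<close>; by compactness it suffices to
  intersect finitely many balls, and there a common point is read off from a maximiser of a concave
  function on the convex hull of the points \<open>((a, u), \<langle>a, u\<rangle>)\<close> (\<open>finite_monotone_set_related\<close>).

  Monotonicity of \<open>A\<close> and cocoercivity of \<open>C\<close> give, for a zero \<open>x\<close> of \<open>A + C\<close>,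
  \<open>\<langle>z - x, z - T z\<rangle> \<ge> (1 - \<gamma> / (4\<beta>)) \<parallel>z - T z\<parallel>\<^sup>2\<close>, and the coefficient is at least \<open>\<delta> / 2\<close>
  (\<open>forward_backward_residual\<close>, \<open>relaxation_bound\<close>). Expanding a relaxed step turns this into the stated descent
  inequality. Summing it shows that the residual \<open>\<parallel>T z\<^sub>k - z\<^sub>k\<parallel>\<close> cannot stay away
  from \<open>0\<close>, so a subsequence of the bounded sequence \<open>z\<close> converges to a fixed point of the
  continuous map \<open>T\<close>, and Fejer monotonicity carries the convergence over to the whole sequence
  (\<open>fejer_convergence\<close>).

  For the rate, the nonexpansiveness of \<open>I - \<gamma> C\<close> bounds an element of \<open>(A + C) (T z)\<close> by
  \<open>\<parallel>z - T z\<parallel> / \<gamma>\<close>. Metric subregularity at \<open>T z\<close> then gives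
  \<open>dist z \<le> (1 + \<kappa> / \<gamma>) \<parallel>z - T z\<parallel>\<close>, where the distance is that to the set of zeros, and this
  is inserted into the descent inequality at the zero nearest to \<open>z\<close>.
\<close>

section \<open>Minty's theorem\<close>

text \<open>A set of pairs is monotone if it is the graph of a monotone operator.\<close>

definition monotone_set :: "('a::real_inner \<times> 'a) set \<Rightarrow> bool" where
  "monotone_set G \<longleftrightarrow> (\<forall>(a, u)\<in>G. \<forall>(b, v)\<in>G. inner (a - b) (u - v) \<ge> 0)"

text \<open>The lifted hull lies above the graph of the duality pairing. The inequality
  \<open>s - \<langle>a, v\<rangle> - \<langle>b, u\<rangle> + r \<ge> 0\<close> is affine in each of \<open>((a, u), s)\<close> and \<open>((b, v), r)\<close> separately, so it
  passes from the generators, where it is monotonicity, to the hull; the diagonal is the claim.\<close>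

lemma monotone_set_hull:
  fixes G :: "('a::real_inner \<times> 'a) set"
  assumes G: "monotone_set G"
    and mem: "((a, u), s) \<in> convex hull ((\<lambda>(a, u). ((a, u), inner a u)) ` G)"
  shows "inner a u \<le> s"
proof -
  let ?L = "(\<lambda>(a, u). ((a, u), inner a u)) ` G"
  define halfspace where "halfspace b v r = {((a, u), s). s - inner a v - inner b u + r \<ge> 0}"
    for b v :: 'a and r :: real
  have conv: "convex (halfspace b v r)" for b v r
  proof (rule convexI, clarsimp simp: halfspace_def)
    fix a1 u1 a2 u2 :: 'a and s1 s2 p q :: real
    assume h: "0 \<le> s1 - inner a1 v - inner b u1 + r" "0 \<le> s2 - inner a2 v - inner b u2 + r"
      and pq: "0 \<le> p" "0 \<le> q" "p + q = 1"
    have "0 \<le> p * (s1 - inner a1 v - inner b u1 + r) + q * (s2 - inner a2 v - inner b u2 + r)"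
      using h pq by simp
    also have "\<dots> = (p * s1 + q * s2) - inner (p *\<^sub>R a1 + q *\<^sub>R a2) v
        - inner b (p *\<^sub>R u1 + q *\<^sub>R u2) + (p + q) * r"
      by (simp add: inner_simps algebra_simps)
    finally show "0 \<le> p * s1 + q * s2 - inner (p *\<^sub>R a1 + q *\<^sub>R a2) v
        - inner b (p *\<^sub>R u1 + q *\<^sub>R u2) + r"
      using pq by simp
  qed
  have gens: "?L \<subseteq> halfspace b v (inner b v)" if "(b, v) \<in> G" for b v
    using G that by (fastforce simp: monotone_set_def halfspace_def inner_simps)
  have "convex hull ?L \<subseteq> halfspace b v (inner b v)" if "(b, v) \<in> G" for b v
    using gens[OF that] conv by (rule hull_minimal)
  then have one: "s - inner a v - inner b u + inner b v \<ge> 0" if "(b, v) \<in> G" for b v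
    using that mem by (fastforce simp: halfspace_def)
  have "?L \<subseteq> halfspace a u s"
    using one by (force simp: halfspace_def inner_commute algebra_simps)
  then have "convex hull ?L \<subseteq> halfspace a u s"
    using conv by (rule hull_minimal)
  then have "((a, u), s) \<in> halfspace a u s"
    using mem by blast
  then show ?thesis
    by (simp add: halfspace_def)
qed

lemma finite_monotone_set_related:
  fixes G :: "('a::euclidean_space \<times> 'a) set"
  assumes G: "monotone_set G" and fin: "finite G"
  shows "\<exists>x. \<forall>(a, u)\<in>G. inner (x - a) (x + u) \<le> 0"
proof (cases "G = {}")
  case False
  define L where "L = (\<lambda>(a, u). ((a, u), inner a u)) ` G"
  define H where "H = convex hull L"
  \<comment> \<open>Lagrangian dual of minimising \<open>max \<langle>x - a, x + u\<rangle>\<close> over \<open>x\<close>: for fixed multipliers with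
    averages \<open>a, u, s\<close> the inner minimum is attained at \<open>x = (a - u) / 2\<close> with value \<open>?\<phi>\<close>.\<close>
  let ?\<phi> = "\<lambda>h::('a \<times> 'a) \<times> real.
    - snd h - (norm ((1/2) *\<^sub>R (fst (fst h) - snd (fst h))))\<^sup>2"
  have "compact H"
    unfolding H_def L_def using fin by (intro compact_convex_hull finite_imp_compact) auto
  moreover have "H \<noteq> {}"
    using False by (simp add: H_def L_def)
  moreover have "continuous_on H ?\<phi>"
    by (intro continuous_intros)
  ultimately obtain h where h: "h \<in> H" "\<And>g. g \<in> H \<Longrightarrow> ?\<phi> g \<le> ?\<phi> h"
    using continuous_attains_sup[of H ?\<phi>] by auto
  obtain a u s where h_eq: "h = ((a, u), s)" by (metis surj_pair)
  define x where "x = (1/2) *\<^sub>R (a - u)"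
  have au: "inner a u \<le> s"
    using monotone_set_hull[OF G] h h_eq by (simp add: H_def L_def)
  have xx: "inner a u + (norm x)\<^sup>2 = (norm ((1/2) *\<^sub>R (a + u)))\<^sup>2"
    unfolding x_def power2_norm_eq_inner
    by (simp add: inner_simps inner_commute field_simps)
  have neg: "- s - (norm x)\<^sup>2 \<le> 0"
    using au xx zero_le_power2[of "norm ((1/2) *\<^sub>R (a + u))"] by linarith
  have "inner (x - b) (x + v) \<le> 0" if bv: "(b, v) \<in> G" for b v
  proof -
    define w where "w = (1/2) *\<^sub>R (b - v)"
    define r where "r = inner b v"
    \<comment> \<open>first-order optimality of \<open>h\<close> along the segment towards the generator of \<open>(b, v)\<close>\<close>
    have step: "t * (s - r - 2 * inner x (w - x)) \<le> t\<^sup>2 * (norm (w - x))\<^sup>2"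
      if t: "0 < t" "t \<le> 1" for t :: real
    proof -
      have "((b, v), r) \<in> H"
        using bv by (force simp: H_def L_def r_def intro: hull_inc)
      then have "(1 - t) *\<^sub>R h + t *\<^sub>R ((b, v), r) \<in> H"
        using h(1) t convex_convex_hull[of L] unfolding H_def
        by (intro convexD_alt) auto
      from h(2)[OF this]
      have "- ((1 - t) * s + t * r) - (norm (x + t *\<^sub>R (w - x)))\<^sup>2 \<le> - s - (norm x)\<^sup>2"
        by (simp add: h_eq x_def w_def algebra_simps)
      then show ?thesis
        unfolding power2_norm_eq_inner
        by (simp add: inner_simps inner_commute algebra_simps power2_eq_square)
    qed
    have "s - r - 2 * inner x (w - x) \<le> 0"
    proof (rule tendsto_lowerbound)
      show "((\<lambda>t. t * (norm (w - x))\<^sup>2) \<longlongrightarrow> 0) (at_right 0)"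
        by (intro tendsto_eq_intros) auto
      show "\<forall>\<^sub>F t in at_right 0. s - r - 2 * inner x (w - x) \<le> t * (norm (w - x))\<^sup>2"
        unfolding eventually_at_right_field
      proof (intro exI[of _ 1] conjI allI impI)
        fix t :: real
        assume t: "0 < t" "t < 1"
        then have "t * (s - r - 2 * inner x (w - x)) \<le> t * (t * (norm (w - x))\<^sup>2)"
          using step[of t] by (simp add: power2_eq_square mult.assoc)
        then show "s - r - 2 * inner x (w - x) \<le> t * (norm (w - x))\<^sup>2"
          using t by simp
      qed auto
    qed auto
    moreover have "inner (x - b) (x + v) = (norm x)\<^sup>2 - 2 * inner x w - r"
      unfolding w_def r_def power2_norm_eq_inner
      by (simp add: inner_simps inner_commute diff_divide_distrib)
    moreover have "inner x (w - x) = inner x w - (norm x)\<^sup>2"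
      unfolding power2_norm_eq_inner by (simp add: inner_simps)
    ultimately show ?thesis
      using neg by linarith
  qed
  then show ?thesis by blast
qed simp

lemma monotone_set_related:
  fixes G :: "('a::euclidean_space \<times> 'a) set"
  assumes G: "monotone_set G"
  shows "\<exists>x. \<forall>(a, u)\<in>G. inner (x - a) (x + u) \<le> 0"
proof -
  define B where "B = (\<lambda>(a, u). {x::'a. inner (x - a) (x + u) \<le> 0})"
  have B_eq: "B (a, u) = cball ((1/2) *\<^sub>R (a - u)) (norm ((1/2) *\<^sub>R (a + u)))" for a u
  proof -
    have "inner (x - a) (x + u) = (norm ((1/2) *\<^sub>R (a - u) - x))\<^sup>2 - (norm ((1/2) *\<^sub>R (a + u)))\<^sup>2"
      for x
      unfolding power2_norm_eq_inner by (simp add: inner_simps inner_commute field_simps)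
    then have "inner (x - a) (x + u) \<le> 0 \<longleftrightarrow>
        norm ((1/2) *\<^sub>R (a - u) - x) \<le> norm ((1/2) *\<^sub>R (a + u))" for x
      by (simp add: abs_le_square_iff[symmetric])
    then show ?thesis
      unfolding B_def cball_def dist_norm prod.case by blast
  qed
  have "\<Inter> (B ` G) \<noteq> {}"
  proof (cases "G = {}")
    case False
    then obtain g where g: "g \<in> G" by blast
    have cpt: "compact (B g')" for g'
      by (cases g') (simp add: B_eq)
    have "B g \<inter> \<Inter> (B ` G) \<noteq> {}"
    proof (rule compact_imp_fip[OF cpt])
      fix \<F>
      assume "finite \<F>" "\<F> \<subseteq> B ` G"
      then obtain G' where G': "finite G'" "G' \<subseteq> G" "\<F> = B ` G'"
        by (meson finite_subset_image)
      then have "monotone_set (insert g G')"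
        using G g unfolding monotone_set_def by blast
      from finite_monotone_set_related[OF this] G' show "B g \<inter> \<Inter> \<F> \<noteq> {}"
        by (fastforce simp: B_def)
    qed (use cpt in \<open>auto intro: compact_imp_closed\<close>)
    then show ?thesis by blast
  qed simp
  then show ?thesis
    by (fastforce simp: B_def)
qed

text \<open>An element that is monotonically related to the whole graph can be added to it.\<close>

lemma maximal_monotone_memI:
  assumes A: "maximal_monotone A"
    and rel: "\<And>a u. u \<in> A a \<Longrightarrow> inner (x - a) (w - u) \<ge> 0"
  shows "w \<in> A x"
proof -
  define S where "S = (\<lambda>a. if a = x then insert w (A a) else A a)"
  have "inner (a - x) (u - w) \<ge> 0" if "u \<in> A a" for a u
    using rel[OF that] by (simp add: inner_simps)
  then have "monotone_operator S"
    using A rel unfolding maximal_monotone_def monotone_operator_def S_def by auto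
  moreover have "gph A \<subseteq> gph S"
    by (auto simp: gph_def S_def)
  ultimately have "gph S = gph A"
    using A by (auto simp: maximal_monotone_def)
  then show ?thesis
    by (auto simp: gph_def S_def set_eq_iff split: if_splits)
qed

lemma maximal_monotone_monotone:
  assumes "maximal_monotone A" "u \<in> A x" "v \<in> A y"
  shows "inner (x - y) (u - v) \<ge> 0"
  using assms by (auto simp: maximal_monotone_def monotone_operator_def)

lemma minty:
  fixes A :: "'a::euclidean_space \<Rightarrow> 'a set"
  assumes A: "maximal_monotone A" and \<gamma>: "0 < \<gamma>"
  shows "\<exists>p. (1 / \<gamma>) *\<^sub>R (y - p) \<in> A p"
proof -
  define G where "G = {(a, \<gamma> *\<^sub>R u - y) | a u. u \<in> A a}"
  have "inner (a - b) ((\<gamma> *\<^sub>R u - y) - (\<gamma> *\<^sub>R v - y)) \<ge> 0" if "u \<in> A a" "v \<in> A b" for a b u v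
    using maximal_monotone_monotone[OF A that] \<gamma>
    by (simp flip: scaleR_diff_right)
  then have "monotone_set G"
    unfolding monotone_set_def G_def by blast
  then obtain p where p: "\<forall>(a, u)\<in>G. inner (p - a) (p + u) \<le> 0"
    using monotone_set_related by blast
  have "(1 / \<gamma>) *\<^sub>R (y - p) \<in> A p"
  proof (rule maximal_monotone_memI[OF A])
    fix a u
    assume "u \<in> A a"
    then have "inner (p - a) (p + (\<gamma> *\<^sub>R u - y)) \<le> 0"
      using p by (auto simp: G_def)
    moreover have "inner (p - a) ((1 / \<gamma>) *\<^sub>R (y - p) - u)
        = - (1 / \<gamma>) * inner (p - a) (p + (\<gamma> *\<^sub>R u - y))"
      using \<gamma> by (simp add: inner_simps field_simps)
    ultimately show "inner (p - a) ((1 / \<gamma>) *\<^sub>R (y - p) - u) \<ge> 0"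
      using \<gamma> by (simp add: divide_le_0_iff)
  qed
  then show ?thesis ..
qed

section \<open>Resolvents and the forward-backward operator\<close>

text \<open>The resolvent is firmly nonexpansive, hence at most single-valued.\<close>

lemma resolvent_firmly_nonexpansive:
  assumes A: "maximal_monotone A" and \<gamma>: "0 < \<gamma>"
    and p: "(1 / \<gamma>) *\<^sub>R (x - p) \<in> A p" and q: "(1 / \<gamma>) *\<^sub>R (y - q) \<in> A q"
  shows "(norm (p - q))\<^sup>2 \<le> inner (p - q) (x - y)"
proof -
  have "0 \<le> inner (p - q) ((1 / \<gamma>) *\<^sub>R (x - p) - (1 / \<gamma>) *\<^sub>R (y - q))"
    by (rule maximal_monotone_monotone[OF A p q])
  also have "\<dots> = (1 / \<gamma>) * (inner (p - q) (x - y) - (norm (p - q))\<^sup>2)"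
    unfolding power2_norm_eq_inner by (simp add: inner_simps algebra_simps)
  finally show ?thesis
    using \<gamma> by (simp add: zero_le_divide_iff)
qed

lemma resolvent_map_eq_iff:
  fixes A :: "'a::euclidean_space \<Rightarrow> 'a set"
  assumes A: "maximal_monotone A" and \<gamma>: "0 < \<gamma>"
  shows "resolvent_map \<gamma> A y = p \<longleftrightarrow> (1 / \<gamma>) *\<^sub>R (y - p) \<in> A p"
proof -
  have mem: "q \<in> resolvent \<gamma> A y \<longleftrightarrow> (1 / \<gamma>) *\<^sub>R (y - q) \<in> A q" for q
  proof
    assume "q \<in> resolvent \<gamma> A y"
    then obtain u where "u \<in> A q" "y = q + \<gamma> *\<^sub>R u"
      by (auto simp: resolvent_def op_inverse_def op_plus_def op_single_def op_scale_def)
    then show "(1 / \<gamma>) *\<^sub>R (y - q) \<in> A q"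
      using \<gamma> by simp
  next
    assume "(1 / \<gamma>) *\<^sub>R (y - q) \<in> A q"
    moreover have "y = q + \<gamma> *\<^sub>R ((1 / \<gamma>) *\<^sub>R (y - q))"
      using \<gamma> by simp
    ultimately show "q \<in> resolvent \<gamma> A y"
      unfolding resolvent_def op_inverse_def op_plus_def op_single_def op_scale_def
      by fastforce
  qed
  have uniq: "q = q'" if "(1 / \<gamma>) *\<^sub>R (y - q) \<in> A q" "(1 / \<gamma>) *\<^sub>R (y - q') \<in> A q'" for q q'
    using resolvent_firmly_nonexpansive[OF A \<gamma> that] by simp
  obtain q where q: "(1 / \<gamma>) *\<^sub>R (y - q) \<in> A q"
    using minty[OF A \<gamma>] by blast
  then have "resolvent \<gamma> A y = {q}"
    using mem uniq by blast
  then have "resolvent_map \<gamma> A y = q"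
    by (simp add: resolvent_map_def)
  then show ?thesis
    using q uniq by blast
qed

lemma resolvent_map_nonexpansive:
  fixes A :: "'a::euclidean_space \<Rightarrow> 'a set"
  assumes A: "maximal_monotone A" and \<gamma>: "0 < \<gamma>"
  shows "norm (resolvent_map \<gamma> A x - resolvent_map \<gamma> A y) \<le> norm (x - y)"
proof -
  let ?d = "resolvent_map \<gamma> A x - resolvent_map \<gamma> A y"
  have "(norm ?d)\<^sup>2 \<le> inner ?d (x - y)"
    using resolvent_map_eq_iff[OF A \<gamma>] by (intro resolvent_firmly_nonexpansive[OF A \<gamma>]) blast+
  also have "\<dots> \<le> norm ?d * norm (x - y)"
    by (rule norm_cauchy_schwarz)
  finally show ?thesis
    by (cases "norm ?d = 0") (simp_all add: power2_eq_square)
qed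

lemma cocoercive_forward_nonexpansive:
  fixes C :: "'a::real_inner \<Rightarrow> 'a"
  assumes C: "cocoercive \<beta> C" and "0 \<le> \<gamma>" "\<gamma> \<le> 2 * \<beta>"
  shows "norm ((x - \<gamma> *\<^sub>R C x) - (y - \<gamma> *\<^sub>R C y)) \<le> norm (x - y)"
proof -
  let ?d = "C x - C y"
  have "\<gamma> * (norm ?d)\<^sup>2 \<le> 2 * (\<beta> * (norm ?d)\<^sup>2)"
    using mult_right_mono[OF assms(3), of "(norm ?d)\<^sup>2"] by simp
  also have "\<dots> \<le> 2 * inner (x - y) ?d"
    using C by (simp add: cocoercive_def)
  finally have "\<gamma> * (\<gamma> * (norm ?d)\<^sup>2) \<le> \<gamma> * (2 * inner (x - y) ?d)"
    using assms(2) by (rule mult_left_mono)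
  moreover have "(norm ((x - y) - \<gamma> *\<^sub>R ?d))\<^sup>2
      = (norm (x - y))\<^sup>2 - \<gamma> * (2 * inner (x - y) ?d) + \<gamma> * (\<gamma> * (norm ?d)\<^sup>2)"
    unfolding power2_norm_eq_inner by (simp add: inner_simps inner_commute algebra_simps)
  ultimately have "(norm ((x - y) - \<gamma> *\<^sub>R ?d))\<^sup>2 \<le> (norm (x - y))\<^sup>2"
    by linarith
  then have "norm ((x - y) - \<gamma> *\<^sub>R ?d) \<le> norm (x - y)"
    by (rule power2_le_imp_le) simp
  then show ?thesis
    by (simp add: algebra_simps)
qed

lemma zero_mem_op_plus_single_iff:
  "x \<in> op_inverse (op_plus A (op_single C)) 0 \<longleftrightarrow> - C x \<in> A x"
  by (force simp: op_inverse_def op_plus_def op_single_def add_eq_0_iff2)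

lemma Fix_forward_backward:
  fixes A :: "'a::euclidean_space \<Rightarrow> 'a set"
  assumes "maximal_monotone A" "0 < \<gamma>"
  shows "Fix (\<lambda>x. resolvent_map \<gamma> A (x - \<gamma> *\<^sub>R C x)) = op_inverse (op_plus A (op_single C)) 0"
  using assms
  by (auto simp: Fix_def zero_mem_op_plus_single_iff resolvent_map_eq_iff)

text \<open>The constant comes from Young's inequality, which absorbs the term \<open>\<langle>z - p, C z - C x\<rangle>\<close> into the
  cocoercivity bound.\<close>

lemma forward_backward_residual:
  fixes A :: "'a::real_inner \<Rightarrow> 'a set"
  assumes A: "maximal_monotone A" and C: "cocoercive \<beta> C" and \<beta>: "0 < \<beta>" and \<gamma>: "0 < \<gamma>"
    and p: "(1 / \<gamma>) *\<^sub>R (z - \<gamma> *\<^sub>R C z - p) \<in> A p" and x: "- C x \<in> A x"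
  shows "(1 - \<gamma> / (4 * \<beta>)) * (norm (z - p))\<^sup>2 \<le> inner (z - x) (z - p)"
proof -
  let ?d = "C z - C x"
  have "0 \<le> \<gamma> * inner (p - x) ((1 / \<gamma>) *\<^sub>R (z - \<gamma> *\<^sub>R C z - p) - (- C x))"
    using maximal_monotone_monotone[OF A p x] \<gamma> by simp
  also have "\<dots> = inner (p - x) (\<gamma> *\<^sub>R ((1 / \<gamma>) *\<^sub>R (z - \<gamma> *\<^sub>R C z - p) - (- C x)))"
    by simp
  also have "\<gamma> *\<^sub>R ((1 / \<gamma>) *\<^sub>R (z - \<gamma> *\<^sub>R C z - p) - (- C x)) = (z - p) - \<gamma> *\<^sub>R ?d"
    using \<gamma> by (simp add: algebra_simps)
  also have "inner (p - x) ((z - p) - \<gamma> *\<^sub>R ?d)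
      = inner (z - x) (z - p) - (norm (z - p))\<^sup>2 - \<gamma> * (inner (z - x) ?d - inner (z - p) ?d)"
    unfolding power2_norm_eq_inner by (simp add: inner_simps inner_commute algebra_simps)
  finally have mono: "\<gamma> * (inner (z - x) ?d - inner (z - p) ?d)
      \<le> inner (z - x) (z - p) - (norm (z - p))\<^sup>2"
    by linarith
  have "0 \<le> \<beta> * (norm (?d - (1 / (2 * \<beta>)) *\<^sub>R (z - p)))\<^sup>2"
    using \<beta> by simp
  also have "\<dots> = \<beta> * (norm ?d)\<^sup>2 - inner (z - p) ?d + (norm (z - p))\<^sup>2 / (4 * \<beta>)"
    unfolding power2_norm_eq_inner using \<beta>
    by (simp add: inner_simps inner_commute field_simps)
  also have "\<dots> \<le> inner (z - x) ?d - inner (z - p) ?d + (norm (z - p))\<^sup>2 / (4 * \<beta>)"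
    using C by (simp add: cocoercive_def)
  finally have "\<gamma> * (- ((norm (z - p))\<^sup>2 / (4 * \<beta>))) \<le> \<gamma> * (inner (z - x) ?d - inner (z - p) ?d)"
    using \<gamma> by (intro mult_left_mono) auto
  with mono show ?thesis
    by (simp add: algebra_simps)
qed

text \<open>With \<open>t = \<beta> / \<gamma> > 1 / 2\<close> the claim is \<open>min 1 t + 1 / 2 \<le> 2 - 1 / (2 t)\<close>; for \<open>t \<le> 1\<close> the
  difference has the sign of \<open>(1 - t) (2 t - 1)\<close>.\<close>

lemma relaxation_bound:
  fixes \<beta> \<gamma> :: real
  assumes \<gamma>: "0 < \<gamma>" "\<gamma> < 2 * \<beta>"
  shows "(min 1 (\<beta> / \<gamma>) + 1 / 2) / 2 \<le> 1 - \<gamma> / (4 * \<beta>)"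
proof (cases "\<beta> \<ge> \<gamma>")
  case True
  then have le: "\<gamma> / (4 * \<beta>) \<le> 1 / 4" and min: "min 1 (\<beta> / \<gamma>) = 1"
    using \<gamma> by (auto simp: field_simps)
  show ?thesis
    unfolding min using diff_left_mono[OF le, of 1] by simp
next
  case False
  then have "0 \<le> (\<gamma> - \<beta>) * (2 * \<beta> - \<gamma>)"
    using \<gamma> by (intro mult_nonneg_nonneg) auto
  then have "(\<beta> / \<gamma> + 1 / 2) / 2 \<le> 1 - \<gamma> / (4 * \<beta>)"
    using \<gamma> by (simp add: field_simps power2_eq_square)
  moreover have "min 1 (\<beta> / \<gamma>) = \<beta> / \<gamma>"
    using False \<gamma> by (simp add: min_def)
  ultimately show ?thesis by (simp only:)
qed

lemma relaxed_step_descent: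
  fixes z p x :: "'a::real_inner"
  assumes "\<delta> / 2 * (norm (p - z))\<^sup>2 \<le> inner (z - x) (z - p)" and "0 \<le> l"
  shows "(norm (z + l *\<^sub>R (p - z) - x))\<^sup>2 \<le> (norm (z - x))\<^sup>2 - l * (\<delta> - l) * (norm (p - z))\<^sup>2"
proof -
  have "2 * l * (\<delta> / 2 * (norm (p - z))\<^sup>2) \<le> 2 * l * inner (z - x) (z - p)"
    using assms by (intro mult_left_mono) auto
  moreover have "(norm (z + l *\<^sub>R (p - z) - x))\<^sup>2
      = (norm (z - x))\<^sup>2 - 2 * l * inner (z - x) (z - p) + l * l * (norm (p - z))\<^sup>2"
    unfolding power2_norm_eq_inner by (simp add: inner_simps inner_commute algebra_simps)
  ultimately show ?thesis
    by (simp add: algebra_simps)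
qed

section \<open>Convergence\<close>

lemma fejer_convergence:
  fixes z :: "nat \<Rightarrow> 'a::euclidean_space" and w :: "nat \<Rightarrow> real"
  assumes cont: "continuous_on UNIV T" and ne: "Fix T \<noteq> {}"
    and w: "\<And>k. 0 \<le> w k" and div: "filterlim (\<lambda>n. \<Sum>k<n. w k) at_top sequentially"
    and desc: "\<And>x k. x \<in> Fix T \<Longrightarrow>
      (norm (z (Suc k) - x))\<^sup>2 \<le> (norm (z k - x))\<^sup>2 - w k * (norm (T (z k) - z k))\<^sup>2"
  shows "\<exists>zstar\<in>Fix T. z \<longlonglongrightarrow> zstar"
proof -
  have dec: "norm (z n - x) \<le> norm (z m - x)" if x: "x \<in> Fix T" and "m \<le> n" for x m n
  proof (rule lift_Suc_antimono_le[of "\<lambda>k. norm (z k - x)", OF _ \<open>m \<le> n\<close>])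
    fix k
    have "0 \<le> w k * (norm (T (z k) - z k))\<^sup>2"
      using w by simp
    then have "(norm (z (Suc k) - x))\<^sup>2 \<le> (norm (z k - x))\<^sup>2"
      using desc[OF x, of k] by linarith
    then show "norm (z (Suc k) - x) \<le> norm (z k - x)"
      by (rule power2_le_imp_le) simp
  qed
  obtain x where x: "x \<in> Fix T"
    using ne by blast
  have telescope: "(\<Sum>k<n. w k * (norm (T (z k) - z k))\<^sup>2)
      \<le> (norm (z 0 - x))\<^sup>2 - (norm (z n - x))\<^sup>2" for n
  proof (induction n)
    case (Suc n)
    then show ?case using desc[OF x, of n] by simp
  qed simp
  have small: "\<exists>k. norm (T (z k) - z k) < e" if e: "0 < e" for e
  proof (rule ccontr)
    assume "\<not> ?thesis"
    then have big: "e\<^sup>2 \<le> (norm (T (z k) - z k))\<^sup>2" for k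
      using e by (intro power_mono) (auto simp: not_less)
    have "(\<Sum>k<n. w k) \<le> (norm (z 0 - x))\<^sup>2 / e\<^sup>2" for n
    proof -
      have "(\<Sum>k<n. w k) * e\<^sup>2 \<le> (\<Sum>k<n. w k * (norm (T (z k) - z k))\<^sup>2)"
        unfolding sum_distrib_right using big w by (intro sum_mono mult_left_mono) auto
      also have "\<dots> \<le> (norm (z 0 - x))\<^sup>2"
        using telescope[of n] zero_le_power2[of "norm (z n - x)"] by linarith
      finally show ?thesis
        using e by (simp add: pos_le_divide_eq)
    qed
    moreover have "\<exists>n. (norm (z 0 - x))\<^sup>2 / e\<^sup>2 < (\<Sum>k<n. w k)"
      using div unfolding filterlim_at_top_dense eventually_sequentially by blast
    ultimately show False
      by (meson not_less)
  qed
  \<comment> \<open>The indices \<open>j n\<close> need not increase: Fejer monotonicity at the limit only asks that some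
    iterate is close to it.\<close>
  have "\<forall>n. \<exists>k. norm (T (z k) - z k) < 1 / real (Suc n)"
    using small by simp
  then obtain j where j: "norm (T (z (j n)) - z (j n)) < 1 / real (Suc n)" for n
    by metis
  have "z k \<in> cball x (norm (z 0 - x))" for k
    using dec[OF x, of 0 k] by (simp add: dist_norm norm_minus_commute)
  then obtain l r where r: "strict_mono r" and l: "(\<lambda>n. z (j (r n))) \<longlonglongrightarrow> l"
    using compact_cball[of x "norm (z 0 - x)"] unfolding compact_def
    by (auto simp: o_def dest!: spec[of _ "\<lambda>n. z (j n)"])
  have "(\<lambda>n. T (z (j (r n)))) \<longlonglongrightarrow> T l"
    using cont l by (auto intro: continuous_on_tendsto_compose)
  then have "(\<lambda>n. T (z (j (r n))) - z (j (r n))) \<longlonglongrightarrow> T l - l"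
    using l by (rule tendsto_diff)
  moreover have "(\<lambda>n. T (z (j n)) - z (j n)) \<longlonglongrightarrow> 0"
    by (rule Lim_null_comparison[OF _ LIMSEQ_Suc[OF lim_1_over_n]])
      (use j in \<open>auto intro!: always_eventually less_imp_le\<close>)
  then have "(\<lambda>n. T (z (j (r n))) - z (j (r n))) \<longlonglongrightarrow> 0"
    using LIMSEQ_subseq_LIMSEQ[OF _ r] by (auto simp: o_def)
  ultimately have "T l - l = 0"
    by (rule LIMSEQ_unique)
  then have lF: "l \<in> Fix T"
    by (simp add: Fix_def)
  have "z \<longlonglongrightarrow> l"
  proof (rule LIMSEQ_I)
    fix e :: real
    assume "0 < e"
    then obtain n where "norm (z (j (r n)) - l) < e"
      using LIMSEQ_D[OF l] by blast
    then show "\<exists>N. \<forall>k\<ge>N. norm (z k - l) < e"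
      using dec[OF lF] by (meson le_less_trans)
  qed
  with lF show ?thesis ..
qed

section \<open>Linear rate under metric subregularity\<close>

lemma set_edist_eq_infdist:
  assumes "S \<noteq> {}"
  shows "set_edist x S = ereal (infdist x S)"
proof (rule antisym)
  show "ereal (infdist x S) \<le> set_edist x S"
    unfolding set_edist_def by (auto intro!: INF_greatest infdist_le simp flip: dist_norm)
  show "set_edist x S \<le> ereal (infdist x S)"
  proof (rule ereal_le_epsilon2)
    fix e :: real
    assume "0 < e"
    then have "infdist x S < infdist x S + e" by simp
    then obtain s where "s \<in> S" "dist x s < infdist x S + e"
      unfolding infdist_notempty[OF assms] cINF_less_iff[OF assms bdd_below_image_dist] by blast
    then show "set_edist x S \<le> ereal (infdist x S) + ereal e"
      unfolding set_edist_def by (auto intro!: INF_lower2[of s] simp: dist_norm)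
  qed
qed

text \<open>Only an upper bound \<open>\<parallel>v\<parallel>\<close> for the distance of \<open>y\<close> to \<open>F x\<close> is used, so the infinite values of
  the distance disappear.\<close>

lemma metrically_subregularD:
  fixes F :: "'a::real_normed_vector \<Rightarrow> 'a set"
  assumes "metrically_subregular F xbar ybar \<kappa>"
  shows "\<exists>U. open U \<and> xbar \<in> U \<and>
    (\<forall>x\<in>U. \<forall>v\<in>F x. infdist x (op_inverse F ybar) \<le> \<kappa> * norm (ybar - v))"
proof -
  obtain U where U: "open U" "xbar \<in> U" "0 < \<kappa>" "ybar \<in> F xbar"
    "\<And>x. x \<in> U \<Longrightarrow> set_edist x (op_inverse F ybar) \<le> ereal \<kappa> * set_edist ybar (F x)"
    using assms by (auto simp: metrically_subregular_def gph_def)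
  have ne: "op_inverse F ybar \<noteq> {}"
    using U by (auto simp: op_inverse_def)
  have "infdist x (op_inverse F ybar) \<le> \<kappa> * norm (ybar - v)" if "x \<in> U" "v \<in> F x" for x v
  proof -
    have "ereal \<kappa> * set_edist ybar (F x) \<le> ereal \<kappa> * ereal (norm (ybar - v))"
      using that U unfolding set_edist_def by (intro ereal_mult_left_mono INF_lower) auto
    with U(5)[OF that(1)] have "set_edist x (op_inverse F ybar) \<le> ereal \<kappa> * ereal (norm (ybar - v))"
      by (rule order_trans)
    then show ?thesis
      by (simp add: set_edist_eq_infdist[OF ne])
  qed
  with U show ?thesis by blast
qed

text \<open>For \<open>p = T z\<close> the vector \<open>((z - \<gamma> C z) - (p - \<gamma> C p)) / \<gamma>\<close> lies in \<open>(A + C) p\<close>, and its norm is at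
  most \<open>\<parallel>z - p\<parallel> / \<gamma>\<close>.\<close>

lemma forward_backward_error_bound:
  fixes A :: "'a::real_inner \<Rightarrow> 'a set"
  assumes C: "cocoercive \<beta> C" and \<gamma>: "0 < \<gamma>" "\<gamma> \<le> 2 * \<beta>" and \<kappa>: "0 < \<kappa>"
    and p: "(1 / \<gamma>) *\<^sub>R (z - \<gamma> *\<^sub>R C z - p) \<in> A p"
    and sub: "\<And>v. v \<in> op_plus A (op_single C) p \<Longrightarrow> infdist p S \<le> \<kappa> * norm v"
  shows "\<gamma> * infdist z S \<le> (\<gamma> + \<kappa>) * norm (p - z)"
proof -
  define v where "v = (1 / \<gamma>) *\<^sub>R ((z - \<gamma> *\<^sub>R C z) - (p - \<gamma> *\<^sub>R C p))"
  have "v = (1 / \<gamma>) *\<^sub>R (z - \<gamma> *\<^sub>R C z - p) + C p"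
    using \<gamma> by (simp add: v_def algebra_simps)
  then have "v \<in> op_plus A (op_single C) p"
    using p by (auto simp: op_plus_def op_single_def)
  then have "infdist p S \<le> \<kappa> * norm v"
    by (rule sub)
  then have "\<gamma> * infdist p S \<le> \<kappa> * (\<gamma> * norm v)"
    using \<gamma> by (simp add: mult.left_commute)
  also have "\<gamma> * norm v \<le> norm (z - p)"
    using cocoercive_forward_nonexpansive[OF C, of \<gamma> z p] \<gamma> by (simp add: v_def)
  finally have "\<gamma> * infdist p S \<le> \<kappa> * norm (p - z)"
    using \<kappa> by (simp add: norm_minus_commute)
  moreover have "\<gamma> * infdist z S \<le> \<gamma> * (infdist p S + norm (p - z))"
    using infdist_triangle[of z S p] \<gamma> by (simp add: dist_norm norm_minus_commute)
  ultimately show ?thesis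
    by (simp add: algebra_simps)
qed

lemma infdist_descent:
  fixes S :: "'a::euclidean_space set"
  assumes S: "closed S" "S \<noteq> {}" and w: "0 \<le> w" and \<gamma>: "0 < \<gamma>" and \<kappa>: "0 < \<kappa>"
    and desc: "\<And>x. x \<in> S \<Longrightarrow> (norm (z' - x))\<^sup>2 \<le> (norm (z - x))\<^sup>2 - w * d\<^sup>2"
    and err: "\<gamma> * infdist z S \<le> (\<gamma> + \<kappa>) * d"
  shows "infdist z' S \<le> sqrt (1 - \<gamma>\<^sup>2 * w / (\<gamma> + \<kappa>)\<^sup>2) * infdist z S"
proof -
  obtain x where x: "x \<in> S" "infdist z S = dist z x"
    using infdist_attains_inf[OF S] by metis
  have "\<gamma> / (\<gamma> + \<kappa>) * infdist z S \<le> d"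
    using err \<gamma> \<kappa> by (simp add: field_simps)
  then have "(\<gamma> / (\<gamma> + \<kappa>) * infdist z S)\<^sup>2 \<le> d\<^sup>2"
    using \<gamma> \<kappa> by (intro power_mono mult_nonneg_nonneg) (auto simp: infdist_nonneg)
  then have "w * (\<gamma> / (\<gamma> + \<kappa>) * infdist z S)\<^sup>2 \<le> w * d\<^sup>2"
    using w by (rule mult_left_mono)
  moreover have "(infdist z' S)\<^sup>2 \<le> (norm (z' - x))\<^sup>2"
    using infdist_le[OF x(1), of z'] by (intro power_mono) (auto simp: dist_norm infdist_nonneg)
  ultimately have "(infdist z' S)\<^sup>2 \<le> (infdist z S)\<^sup>2 - w * (\<gamma> / (\<gamma> + \<kappa>) * infdist z S)\<^sup>2"
    using desc[OF x(1)] x(2) by (simp add: dist_norm)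
  also have "\<dots> = (1 - \<gamma>\<^sup>2 * w / (\<gamma> + \<kappa>)\<^sup>2) * (infdist z S)\<^sup>2"
    by (simp add: power_mult_distrib power_divide algebra_simps)
  \<comment> \<open>The sign of the radicand is irrelevant, since \<open>sqrt\<close> is multiplicative on all reals.\<close>
  finally have "infdist z' S \<le> sqrt ((1 - \<gamma>\<^sup>2 * w / (\<gamma> + \<kappa>)\<^sup>2) * (infdist z S)\<^sup>2)"
    by (rule real_le_rsqrt)
  then show ?thesis
    by (simp add: real_sqrt_mult infdist_nonneg)
qed

section \<open>Over-relaxed forward-backward splitting\<close>

theorem theorem3p2:
  fixes A F :: "'a::euclidean_space \<Rightarrow> 'a set"
    and C T :: "'a \<Rightarrow> 'a"
    and \<beta> \<gamma> \<delta> :: real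
    and lam :: "nat \<Rightarrow> real"
    and z :: "nat \<Rightarrow> 'a"
  assumes "maximal_monotone A"
    and "\<beta> > 0" and "cocoercive \<beta> C"
    and F_def: "F = op_plus A (op_single C)"
    and "op_inverse F 0 \<noteq> {}"
    and "0 < \<gamma>" and "\<gamma> < 2 * \<beta>"
    and \<delta>_def: "\<delta> = min 1 (\<beta> / \<gamma>) + 1 / 2"
    and "\<And>k. 0 \<le> lam k \<and> lam k \<le> \<delta>"
    and "filterlim (\<lambda>n. \<Sum>k<n. lam k * (\<delta> - lam k)) at_top sequentially"
    and T_def: "T = (\<lambda>x. resolvent_map \<gamma> A (x - \<gamma> *\<^sub>R C x))"
    and "\<And>k. z (Suc k) = z k + lam k *\<^sub>R (T (z k) - z k)"
  shows "Fix T = op_inverse F 0 \<and>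
    (\<forall>x\<in>op_inverse F 0. \<forall>k.
       (norm (z (Suc k) - x))\<^sup>2
         \<le> (norm (z k - x))\<^sup>2 - lam k * (\<delta> - lam k) * (norm (T (z k) - z k))\<^sup>2) \<and>
    (\<exists>zstar\<in>Fix T.
       z \<longlonglongrightarrow> zstar \<and> (\<lambda>k. T (z k)) \<longlonglongrightarrow> zstar \<and>
       (\<forall>\<kappa>>0. metrically_subregular F zstar 0 \<kappa> \<longrightarrow>
          (\<exists>kbar. \<forall>k\<ge>kbar.
             set_edist (z (Suc k)) (op_inverse F 0)
               \<le> ereal (sqrt (1 - \<gamma>\<^sup>2 * lam k * (\<delta> - lam k) / (\<gamma> + \<kappa>)\<^sup>2))
                   * set_edist (z k) (op_inverse F 0))))"
proof -
  note A = assms(1) and \<beta> = assms(2) and C = assms(3) and ne = assms(5)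
    and \<gamma> = assms(6,7) and lam = assms(9) and div = assms(10) and step = assms(12)
  let ?S = "op_inverse F 0"
  have fix_eq: "Fix T = ?S"
    unfolding T_def F_def by (rule Fix_forward_backward[OF A \<gamma>(1)])
  have T_mem: "(1 / \<gamma>) *\<^sub>R (x - \<gamma> *\<^sub>R C x - T x) \<in> A (T x)" for x
    by (simp add: T_def flip: resolvent_map_eq_iff[OF A \<gamma>(1)])
  have desc: "(norm (z (Suc k) - x))\<^sup>2
      \<le> (norm (z k - x))\<^sup>2 - lam k * (\<delta> - lam k) * (norm (T (z k) - z k))\<^sup>2"
    if "x \<in> ?S" for x k
  proof -
    have "- C x \<in> A x"
      using that by (simp add: F_def zero_mem_op_plus_single_iff)
    then have res: "(1 - \<gamma> / (4 * \<beta>)) * (norm (z k - T (z k)))\<^sup>2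
        \<le> inner (z k - x) (z k - T (z k))"
      by (rule forward_backward_residual[OF A C \<beta> \<gamma>(1) T_mem])
    have "\<delta> / 2 * (norm (z k - T (z k)))\<^sup>2 \<le> (1 - \<gamma> / (4 * \<beta>)) * (norm (z k - T (z k)))\<^sup>2"
      unfolding \<delta>_def using relaxation_bound[OF \<gamma>] by (rule mult_right_mono) simp
    also note res
    finally show ?thesis
      unfolding step[of k] using lam[of k]
      by (intro relaxed_step_descent) (auto simp: norm_minus_commute)
  qed
  have nonexp: "norm (T x - T y) \<le> norm (x - y)" for x y
    unfolding T_def using \<gamma>
    by (intro order_trans[OF resolvent_map_nonexpansive[OF A \<gamma>(1)]
          cocoercive_forward_nonexpansive[OF C]]) auto
  have cont: "continuous_on UNIV T"
    unfolding continuous_on_iff dist_norm using nonexp by (meson le_less_trans)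
  have w: "0 \<le> lam k * (\<delta> - lam k)" for k
    using lam[of k] by simp
  obtain zstar where zstar: "zstar \<in> Fix T" and lim: "z \<longlonglongrightarrow> zstar"
    using fejer_convergence[OF cont _ w div, of z] desc ne unfolding fix_eq by blast
  have "(\<lambda>k. T (z k)) \<longlonglongrightarrow> T zstar"
    using cont lim by (auto intro: continuous_on_tendsto_compose)
  then have limT: "(\<lambda>k. T (z k)) \<longlonglongrightarrow> zstar"
    using zstar by (simp add: Fix_def)
  have "closed {x. T x = x}"
    using cont by (intro closed_Collect_eq continuous_on_id)
  then have closed: "closed ?S"
    by (simp add: Fix_def flip: fix_eq)
  have rate: "\<exists>kbar. \<forall>k\<ge>kbar. set_edist (z (Suc k)) ?S
      \<le> ereal (sqrt (1 - \<gamma>\<^sup>2 * lam k * (\<delta> - lam k) / (\<gamma> + \<kappa>)\<^sup>2)) * set_edist (z k) ?S"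
    if \<kappa>: "0 < \<kappa>" and sub: "metrically_subregular F zstar 0 \<kappa>" for \<kappa>
  proof -
    obtain U where U: "open U" "zstar \<in> U"
      "\<And>x v. x \<in> U \<Longrightarrow> v \<in> F x \<Longrightarrow> infdist x ?S \<le> \<kappa> * norm v"
      using metrically_subregularD[OF sub] by auto
    \<comment> \<open>Subregularity is applied at \<open>T (z k)\<close>, where an element of \<open>F\<close> is at hand.\<close>
    obtain kbar where kbar: "\<And>k. k \<ge> kbar \<Longrightarrow> T (z k) \<in> U"
      using topological_tendstoD[OF limT U(1,2)] unfolding eventually_sequentially by blast
    have "infdist (z (Suc k)) ?S
        \<le> sqrt (1 - \<gamma>\<^sup>2 * (lam k * (\<delta> - lam k)) / (\<gamma> + \<kappa>)\<^sup>2) * infdist (z k) ?S"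
      if "k \<ge> kbar" for k
    proof (rule infdist_descent[OF closed ne w \<gamma>(1) \<kappa> desc])
      show "\<gamma> * infdist (z k) ?S \<le> (\<gamma> + \<kappa>) * norm (T (z k) - z k)"
        using \<gamma> U(3)[OF kbar[OF that]]
        by (intro forward_backward_error_bound[where A = A and p = "T (z k)", OF C _ _ \<kappa> T_mem])
          (auto simp: F_def)
    qed
    then show ?thesis
      by (intro exI[of _ kbar]) (simp add: set_edist_eq_infdist[OF ne] mult.assoc)
  qed
  show ?thesis
    using fix_eq desc zstar lim limT rate by blast
qed

end
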